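(* Let $(\mathcal{A},\alpha)$ be a unital Krein $C^*$-algebra, $\mathcal{B}$ a $C^*$-algebra, $(\mathcal{H}_1,J_1)$ and $(\mathcal{H}_2,J_2=\mathrm{id}_{\mathcal{H}_2})$ Krein $\mathcal{B}$-modules, and $\varphi:\mathcal{A}\to\mathcal{L}(\mathcal{H}_1)$ an $\alpha$-completely positive map. Let $\mathcal{X}$ be a Hilbert $\mathcal{A}$-module and $\Phi:\mathcal{X}\to\mathcal{L}(\mathcal{H}_1,\mathcal{H}_2)$ a $\varphi$-map. If $(\pi_{\mathcal{X}},\pi_\varphi,V_\Phi,W_\Phi,(\mathcal{K}_1,J_3),(\mathcal{K}_2,J_4))$ and $(\pi'_{\mathcal{X}},\pi'_\varphi,V'_\Phi,W'_\Phi,(\mathcal{K}'_1,J'_3),(\mathcal{K}'_2,J'_4))$ are two minimal KSGNS constructions for $\Phi$, then there are two unitary operators $U_1:\mathcal{K}_1\to\mathcal{K}'_1$ and $U_2:\mathcal{K}_2\to\mathcal{K}'_2$ such that: (1) $U_1V_\Phi=V'_\Phi$ and $U_1\pi_\varphi(a)U_1^{\#}=\pi'_\varphi(a)$ for all $a\in\mathcal{A}$; (2) $U_2W_\Phi=W'_\Phi$ and $U_2\pi_{\mathcal{X}}(x)U_1^{\#}=\pi'_{\mathcal{X}}(x)$ for all $x\in\mathcal{X}$.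
   Context: Maps and operators are bounded and linear. $\mathcal{L}(\mathcal{X},\mathcal{Y})$ denotes the adjointable operators between Hilbert $C^*$-modules, $\mathcal{L}(\mathcal{X})=\mathcal{L}(\mathcal{X},\mathcal{X})$; inner products are linear in the second variable. A coisometry is an adjointable $W$ with $WW^*=\mathrm{id}$; a unitary is an adjointable $U$ with $U^*U=\mathrm{id}$, $UU^*=\mathrm{id}$. $[S]$ denotes the closed linear span of $S$. Krein $C^*$-algebra: a pair $(\mathcal{A},\alpha)$ with $\mathcal{A}$ a $C^*$-algebra and $\alpha$ a $*$-automorphism of $\mathcal{A}$ with $\alpha^2=\mathrm{id}$; put $a^{\#}=\alpha(a^* )$. Krein $\mathcal{B}$-module: a pair $(\mathcal{H},J)$ with $\mathcal{H}$ a Hilbert $\mathcal{B}$-module and $J\in\mathcal{L}(\mathcal{H})$, $J=J^*=J^{-1}$. For Krein modules $(\mathcal{H},J)$, $(\mathcal{H}',J')$ and $T\in\mathcal{L}(\mathcal{H},\mathcal{H}')$ put $T^{\#}=JT^*J'\in\mathcal{L}(\mathcal{H}',\mathcal{H})$. $\alpha$-completely positive ($\alpha$-CP) map of $\mathcal{A}$ on $(\mathcal{H},J)$: a map $\varphi:\mathcal{A}\to\mathcal{L}(\mathcal{H})$ with $\varphi(a^* )=\varphi(a)^*$ such that (i) $\varphi(\alpha(a))=J\varphi(a)J=\varphi(a)$ for all $a$ (equivalently $\varphi(a^{\#})=\varphi(a)^{\#}=\varphi(a^* )$); (ii) the matrix $[\varphi(a_i^{\#}a_j)]_{i,j=1}^n$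 is positive for all $n\ge1$ and $a_1,\dots,a_n\in\mathcal{A}$, i.e. $\sum_{i,j}\langle\xi_i,\varphi(\alpha(a_i)^*a_j)\xi_j\rangle\ge0$ for all $\xi_1,\dots,\xi_n\in\mathcal{H}$; (iii) for every $a\in\mathcal{A}$ there is $M(a)>0$ with $[\varphi((aa_i)^{\#}aa_j)]_{i,j=1}^n\le M(a)[\varphi(a_i^{\#}a_j)]_{i,j=1}^n$ for all $n\ge1$ and $a_1,\dots,a_n\in\mathcal{A}$. $\varphi$-map: for an $\alpha$-CP map $\varphi:\mathcal{A}\to\mathcal{L}(\mathcal{H}_1)$, a map $\Phi:\mathcal{X}\to\mathcal{L}(\mathcal{H}_1,\mathcal{H}_2)$ with $\Phi(x)^{\#}\Phi(y)=\varphi(\langle x,y\rangle)$ for all $x,y\in\mathcal{X}$. Representation of $\mathcal{A}$ on a Krein module $(\mathcal{K},J)$: a homomorphism $\pi:\mathcal{A}\to\mathcal{L}(\mathcal{K})$ with $\pi(a^* )=J\pi(a)^*J=\pi(a)^{\#}$ for all $a$. $\pi_{\mathcal{A}}$-representation of $\mathcal{X}$ on Krein modules $(\mathcal{K}_1,J_3)$, $(\mathcal{K}_2,J_4)$, where $\pi_{\mathcal{A}}$ is a representation of $\mathcal{A}$ on $(\mathcal{K}_1,J_3)$: a map $\pi_{\mathcal{X}}:\mathcal{X}\to\mathcal{L}(\mathcal{K}_1,\mathcal{K}_2)$ with $\pi_{\mathcal{X}}(x)^{\#}\pi_{\mathcal{X}}(y)=\pi_{\mathcal{A}}(\langle x,y\rangle)$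 for all $x,y\in\mathcal{X}$. KSGNS construction associated to the $\varphi$-map $\Phi$: a six-tuple $(\pi_{\mathcal{X}},\pi_\varphi,V_\Phi,W_\Phi,(\mathcal{K}_1,J_3),(\mathcal{K}_2,J_4))$ where $(\mathcal{K}_1,J_3)$ and $(\mathcal{K}_2,J_4=\mathrm{id}_{\mathcal{K}_2})$ are Krein $\mathcal{B}$-modules, $\pi_\varphi$ is a representation of $\mathcal{A}$ on $(\mathcal{K}_1,J_3)$, $\pi_{\mathcal{X}}$ is a $\pi_\varphi$-representation of $\mathcal{X}$ on $(\mathcal{K}_1,J_3)$ and $(\mathcal{K}_2,J_4)$, and $V_\Phi\in\mathcal{L}(\mathcal{H}_1,\mathcal{K}_1)$, $W_\Phi\in\mathcal{L}(\mathcal{H}_2,\mathcal{K}_2)$ satisfy: $V_\Phi^{\#}=V_\Phi^*$; $\pi_\varphi(\alpha(a))V_\Phi=J_3\pi_\varphi(a)V_\Phi J_1$ for all $a\in\mathcal{A}$; $W_\Phi$ is a coisometry with $W_\Phi^{\#}=W_\Phi^*$; $\varphi(a)=V_\Phi^{\#}\pi_\varphi(a)V_\Phi$ for all $a\in\mathcal{A}$; $\Phi(x)=W_\Phi^{\#}\pi_{\mathcal{X}}(x)V_\Phi$ for all $x\in\mathcal{X}$. It is minimal if $\mathcal{K}_2=[\pi_{\mathcal{X}}(\mathcal{X})V_\Phi\mathcal{H}_1]$ and $\mathcal{K}_1=[\pi_\varphi(\mathcal{A})V_\Phi\mathcal{H}_1]$. *)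

theory Defs
  imports "HOL-Analysis.Analysis"
begin

class scaleC =
  fixes scaleC :: "complex \<Rightarrow> 'a \<Rightarrow> 'a"  (infixr "*\<^sub>C" 75)

class complex_banach = banach + scaleC +
  assumes scaleC_add_right: "c *\<^sub>C (x + y) = c *\<^sub>C x + c *\<^sub>C y"
    and scaleC_add_left: "(c + d) *\<^sub>C x = c *\<^sub>C x + d *\<^sub>C x"
    and scaleC_scaleC: "c *\<^sub>C d *\<^sub>C x = (c * d) *\<^sub>C x"
    and scaleC_one: "1 *\<^sub>C x = x"
    and scaleR_scaleC: "r *\<^sub>R x = complex_of_real r *\<^sub>C x"
    and norm_scaleC: "norm (c *\<^sub>C x) = cmod c * norm x"

lemma vector_space_scaleC:
  "vector_space (scaleC :: complex \<Rightarrow> 'v \<Rightarrow> 'v::complex_banach)"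
  by unfold_locales
    (simp_all add: scaleC_add_right scaleC_add_left scaleC_scaleC scaleC_one)

text \<open>No unit is required, and the zero algebra is allowed.\<close>

class cstar_algebra = complex_banach + real_normed_algebra +
  fixes star :: "'a \<Rightarrow> 'a"
  assumes mult_scaleC_left: "(c *\<^sub>C x) * y = c *\<^sub>C (x * y)"
    and mult_scaleC_right: "x * (c *\<^sub>C y) = c *\<^sub>C (x * y)"
    and star_star: "star (star x) = x"
    and star_add: "star (x + y) = star x + star y"
    and star_scaleC: "star (c *\<^sub>C x) = cnj c *\<^sub>C star x"
    and star_mult: "star (x * y) = star y * star x"
    and norm_star_mult: "norm (star x * x) = (norm x)\<^sup>2"

definition cstar_pos :: "'a::cstar_algebra \<Rightarrow> bool" where
  "cstar_pos a \<longleftrightarrow> (\<exists>b. a = star b * b)"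

definition unital :: "'a::cstar_algebra itself \<Rightarrow> bool" where
  "unital _ \<longleftrightarrow> (\<exists>e::'a. \<forall>a. e * a = a \<and> a * e = a)"

abbreviation clinear :: "('v::complex_banach \<Rightarrow> 'w::complex_banach) \<Rightarrow> bool" where
  "clinear \<equiv> Vector_Spaces.linear scaleC scaleC"

definition closed_cspan :: "'v::complex_banach set \<Rightarrow> 'v set" where
  "closed_cspan S = closure (module.span scaleC S)"

text \<open>Right Hilbert modules over the C*-algebra \<open>'b\<close>. The underlying complex Banach space
  is the type \<open>'h\<close>; completeness is part of its class, and the last axiom of
  \<open>hilbert_module\<close> says that its norm is the one given by the inner product.\<close>

record ('h, 'b) hilbert_mod =
  act :: "'h \<Rightarrow> 'b \<Rightarrow> 'h"
  ip :: "'h \<Rightarrow> 'h \<Rightarrow> 'b"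

definition hilbert_module ::
    "('h::complex_banach, 'b::cstar_algebra) hilbert_mod \<Rightarrow> bool" where
  "hilbert_module H \<longleftrightarrow>
     (\<forall>x y b. act H (x + y) b = act H x b + act H y b) \<and>
     (\<forall>x b c. act H x (b + c) = act H x b + act H x c) \<and>
     (\<forall>x b c. act H x (b * c) = act H (act H x b) c) \<and>
     (\<forall>k x b. act H (k *\<^sub>C x) b = k *\<^sub>C act H x b) \<and>
     (\<forall>k x b. act H x (k *\<^sub>C b) = k *\<^sub>C act H x b) \<and>
     (\<forall>x y z. ip H x (y + z) = ip H x y + ip H x z) \<and>
     (\<forall>k x y. ip H x (k *\<^sub>C y) = k *\<^sub>C ip H x y) \<and>
     (\<forall>x y b. ip H x (act H y b) = ip H x y * b) \<and>
     (\<forall>x y. ip H y x = star (ip H x y)) \<and>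
     (\<forall>x. cstar_pos (ip H x x)) \<and>
     (\<forall>x. ip H x x = 0 \<longrightarrow> x = 0) \<and>
     (\<forall>x. norm x = sqrt (norm (ip H x x)))"

definition is_adjoint where
  "is_adjoint H K T S \<longleftrightarrow> (\<forall>x y. ip K (T x) y = ip H x (S y))"

definition adjointable ::
    "('h::complex_banach, 'b::cstar_algebra) hilbert_mod \<Rightarrow> ('k::complex_banach, 'b) hilbert_mod
     \<Rightarrow> ('h \<Rightarrow> 'k) set" where
  "adjointable H K = {T. clinear T \<and> bounded_linear T \<and> (\<exists>S. is_adjoint H K T S)}"

text \<open>The adjoint is unique on Hilbert modules, since the inner product is definite.\<close>

definition adj ::
    "('h::complex_banach, 'b::cstar_algebra) hilbert_mod \<Rightarrow> ('k::complex_banach, 'b) hilbert_mod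
     \<Rightarrow> ('h \<Rightarrow> 'k) \<Rightarrow> 'k \<Rightarrow> 'h" where
  "adj H K T = (THE S. is_adjoint H K T S)"

definition coisometry ::
    "('h::complex_banach, 'b::cstar_algebra) hilbert_mod \<Rightarrow> ('k::complex_banach, 'b) hilbert_mod
     \<Rightarrow> ('h \<Rightarrow> 'k) \<Rightarrow> bool" where
  "coisometry H K W \<longleftrightarrow> W \<in> adjointable H K \<and> W \<circ> adj H K W = id"

definition unitary ::
    "('h::complex_banach, 'b::cstar_algebra) hilbert_mod \<Rightarrow> ('k::complex_banach, 'b) hilbert_mod
     \<Rightarrow> ('h \<Rightarrow> 'k) \<Rightarrow> bool" where
  "unitary H K U \<longleftrightarrow> U \<in> adjointable H K \<and> adj H K U \<circ> U = id \<and> U \<circ> adj H K U = id"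

text \<open>Bounded linear maps into \<open>\<L>(H, K)\<close>, the latter with the operator norm.\<close>

definition bounded_linear_op_map ::
    "('h::complex_banach, 'b::cstar_algebra) hilbert_mod \<Rightarrow> ('k::complex_banach, 'b) hilbert_mod
     \<Rightarrow> ('v::complex_banach \<Rightarrow> 'h \<Rightarrow> 'k) \<Rightarrow> bool" where
  "bounded_linear_op_map H K F \<longleftrightarrow>
     (\<forall>v. F v \<in> adjointable H K) \<and>
     (\<forall>v w. F (v + w) = (\<lambda>\<xi>. F v \<xi> + F w \<xi>)) \<and>
     (\<forall>c v. F (c *\<^sub>C v) = (\<lambda>\<xi>. c *\<^sub>C F v \<xi>)) \<and>
     (\<exists>C. \<forall>v. onorm (F v) \<le> C * norm v)"

definition krein_cstar_algebra :: "('a::cstar_algebra \<Rightarrow> 'a) \<Rightarrow> bool" where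
  "krein_cstar_algebra \<alpha> \<longleftrightarrow>
     clinear \<alpha> \<and> bij \<alpha> \<and>
     (\<forall>a b. \<alpha> (a * b) = \<alpha> a * \<alpha> b) \<and>
     (\<forall>a. \<alpha> (star a) = star (\<alpha> a)) \<and>
     \<alpha> \<circ> \<alpha> = id"

definition alg_sharp :: "('a::cstar_algebra \<Rightarrow> 'a) \<Rightarrow> 'a \<Rightarrow> 'a" where
  "alg_sharp \<alpha> a = \<alpha> (star a)"

type_synonym ('h, 'b) krein_mod = "('h, 'b) hilbert_mod \<times> ('h \<Rightarrow> 'h)"

fun krein_module :: "('h::complex_banach, 'b::cstar_algebra) krein_mod \<Rightarrow> bool" where
  "krein_module (H, J) \<longleftrightarrow>
     hilbert_module H \<and> J \<in> adjointable H H \<and> adj H H J = J \<and> J \<circ> J = id"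

fun sharp ::
    "('h::complex_banach, 'b::cstar_algebra) krein_mod \<Rightarrow> ('k::complex_banach, 'b) krein_mod
     \<Rightarrow> ('h \<Rightarrow> 'k) \<Rightarrow> 'k \<Rightarrow> 'h" where
  "sharp (H, J) (H', J') T = J \<circ> adj H H' T \<circ> J'"

text \<open>Positivity of an \<open>n \<times> n\<close> matrix over \<open>\<L>(H)\<close>, i.e. as an operator on \<open>H\<^sup>n\<close>.\<close>

definition op_matrix_pos ::
    "('h::complex_banach, 'b::cstar_algebra) hilbert_mod \<Rightarrow> nat \<Rightarrow> (nat \<Rightarrow> nat \<Rightarrow> 'h \<Rightarrow> 'h) \<Rightarrow> bool"
  where
  "op_matrix_pos H n T \<longleftrightarrow>
     (\<forall>\<xi>. cstar_pos (\<Sum>i<n. \<Sum>j<n. ip H (\<xi> i) (T i j (\<xi> j))))"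

definition op_matrix_le ::
    "('h::complex_banach, 'b::cstar_algebra) hilbert_mod \<Rightarrow> nat
     \<Rightarrow> (nat \<Rightarrow> nat \<Rightarrow> 'h \<Rightarrow> 'h) \<Rightarrow> (nat \<Rightarrow> nat \<Rightarrow> 'h \<Rightarrow> 'h) \<Rightarrow> bool" where
  "op_matrix_le H n S T \<longleftrightarrow> op_matrix_pos H n (\<lambda>i j \<xi>. T i j \<xi> - S i j \<xi>)"

fun alpha_cp ::
    "('a::cstar_algebra \<Rightarrow> 'a) \<Rightarrow> ('h::complex_banach, 'b::cstar_algebra) krein_mod
     \<Rightarrow> ('a \<Rightarrow> 'h \<Rightarrow> 'h) \<Rightarrow> bool" where
  "alpha_cp \<alpha> (H, J) \<phi> \<longleftrightarrow>
     bounded_linear_op_map H H \<phi> \<and>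
     (\<forall>a. \<phi> (star a) = adj H H (\<phi> a)) \<and>
     (\<forall>a. \<phi> (\<alpha> a) = J \<circ> \<phi> a \<circ> J \<and> J \<circ> \<phi> a \<circ> J = \<phi> a) \<and>
     (\<forall>n\<ge>1. \<forall>a. op_matrix_pos H n (\<lambda>i j. \<phi> (alg_sharp \<alpha> (a i) * a j))) \<and>
     (\<forall>a. \<exists>M>0. \<forall>n\<ge>1. \<forall>b.
        op_matrix_le H n
          (\<lambda>i j. \<phi> (alg_sharp \<alpha> (a * b i) * (a * b j)))
          (\<lambda>i j \<xi>. M *\<^sub>R \<phi> (alg_sharp \<alpha> (b i) * b j) \<xi>))"

fun phi_map ::
    "('a::cstar_algebra \<Rightarrow> 'h1 \<Rightarrow> 'h1) \<Rightarrow> ('x::complex_banach, 'a) hilbert_mod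
     \<Rightarrow> ('h1::complex_banach, 'b::cstar_algebra) krein_mod
     \<Rightarrow> ('h2::complex_banach, 'b) krein_mod
     \<Rightarrow> ('x \<Rightarrow> 'h1 \<Rightarrow> 'h2) \<Rightarrow> bool" where
  "phi_map \<phi> X (H1, J1) (H2, J2) \<Phi> \<longleftrightarrow>
     bounded_linear_op_map H1 H2 \<Phi> \<and>
     (\<forall>x y. sharp (H1, J1) (H2, J2) (\<Phi> x) \<circ> \<Phi> y = \<phi> (ip X x y))"

fun representation ::
    "('h::complex_banach, 'b::cstar_algebra) krein_mod
     \<Rightarrow> ('a::cstar_algebra \<Rightarrow> 'h \<Rightarrow> 'h) \<Rightarrow> bool" where
  "representation (K, J) \<pi> \<longleftrightarrow>
     bounded_linear_op_map K K \<pi> \<and>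
     (\<forall>a b. \<pi> (a * b) = \<pi> a \<circ> \<pi> b) \<and>
     (\<forall>a. \<pi> (star a) = sharp (K, J) (K, J) (\<pi> a))"

fun module_representation ::
    "('a::cstar_algebra \<Rightarrow> 'k1 \<Rightarrow> 'k1) \<Rightarrow> ('x::complex_banach, 'a) hilbert_mod
     \<Rightarrow> ('k1::complex_banach, 'b::cstar_algebra) krein_mod
     \<Rightarrow> ('k2::complex_banach, 'b) krein_mod
     \<Rightarrow> ('x \<Rightarrow> 'k1 \<Rightarrow> 'k2) \<Rightarrow> bool" where
  "module_representation \<pi> X (K1, J3) (K2, J4) \<pi>X \<longleftrightarrow>
     bounded_linear_op_map K1 K2 \<pi>X \<and>
     (\<forall>x y. sharp (K1, J3) (K2, J4) (\<pi>X x) \<circ> \<pi>X y = \<pi> (ip X x y))"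

type_synonym ('x, 'a, 'h1, 'h2, 'k1, 'k2, 'b) ksgns_tuple =
  "('x \<Rightarrow> 'k1 \<Rightarrow> 'k2) \<times> ('a \<Rightarrow> 'k1 \<Rightarrow> 'k1) \<times> ('h1 \<Rightarrow> 'k1) \<times> ('h2 \<Rightarrow> 'k2)
   \<times> ('k1, 'b) krein_mod \<times> ('k2, 'b) krein_mod"

fun ksgns_construction ::
    "('a::cstar_algebra \<Rightarrow> 'a) \<Rightarrow> ('x::complex_banach, 'a) hilbert_mod
     \<Rightarrow> ('h1::complex_banach, 'b::cstar_algebra) krein_mod
     \<Rightarrow> ('h2::complex_banach, 'b) krein_mod
     \<Rightarrow> ('a \<Rightarrow> 'h1 \<Rightarrow> 'h1) \<Rightarrow> ('x \<Rightarrow> 'h1 \<Rightarrow> 'h2)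
     \<Rightarrow> ('x, 'a, 'h1, 'h2, 'k1::complex_banach, 'k2::complex_banach, 'b) ksgns_tuple \<Rightarrow> bool"
  where
  "ksgns_construction \<alpha> X (H1, J1) (H2, J2) \<phi> \<Phi> (\<pi>X, \<pi>, V, W, (K1, J3), (K2, J4)) \<longleftrightarrow>
     krein_module (K1, J3) \<and> krein_module (K2, J4) \<and> J4 = id \<and>
     representation (K1, J3) \<pi> \<and>
     module_representation \<pi> X (K1, J3) (K2, J4) \<pi>X \<and>
     V \<in> adjointable H1 K1 \<and> W \<in> adjointable H2 K2 \<and>
     sharp (H1, J1) (K1, J3) V = adj H1 K1 V \<and>
     (\<forall>a. \<pi> (\<alpha> a) \<circ> V = J3 \<circ> \<pi> a \<circ> V \<circ> J1) \<and>
     coisometry H2 K2 W \<and> sharp (H2, J2) (K2, J4) W = adj H2 K2 W \<and>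
     (\<forall>a. \<phi> a = sharp (H1, J1) (K1, J3) V \<circ> \<pi> a \<circ> V) \<and>
     (\<forall>x. \<Phi> x = sharp (H2, J2) (K2, J4) W \<circ> \<pi>X x \<circ> V)"

fun minimal_ksgns_construction ::
    "('a::cstar_algebra \<Rightarrow> 'a) \<Rightarrow> ('x::complex_banach, 'a) hilbert_mod
     \<Rightarrow> ('h1::complex_banach, 'b::cstar_algebra) krein_mod
     \<Rightarrow> ('h2::complex_banach, 'b) krein_mod
     \<Rightarrow> ('a \<Rightarrow> 'h1 \<Rightarrow> 'h1) \<Rightarrow> ('x \<Rightarrow> 'h1 \<Rightarrow> 'h2)
     \<Rightarrow> ('x, 'a, 'h1, 'h2, 'k1::complex_banach, 'k2::complex_banach, 'b) ksgns_tuple \<Rightarrow> bool"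
  where
  "minimal_ksgns_construction \<alpha> X (H1, J1) (H2, J2) \<phi> \<Phi> (\<pi>X, \<pi>, V, W, (K1, J3), (K2, J4)) \<longleftrightarrow>
     ksgns_construction \<alpha> X (H1, J1) (H2, J2) \<phi> \<Phi> (\<pi>X, \<pi>, V, W, (K1, J3), (K2, J4)) \<and>
     closed_cspan {\<pi>X x (V \<xi>) | x \<xi>. True} = UNIV \<and>
     closed_cspan {\<pi> a (V \<xi>) | a \<xi>. True} = UNIV"

end

theory Submission imports Defs begin

text \<open>
  Both spaces of a minimal construction are determined, up to a unitary, by Gram data that only
  mention \<open>\<phi>\<close>, \<open>\<alpha>\<close>, \<open>J1\<close>. The representation property says \<open>\<pi>(a)\<^sup>* = J3 \<pi>(a\<^sup>*) J3\<close>, and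
  the relation \<open>\<pi>(\<alpha>(a)) V = J3 \<pi>(a) V J1\<close> lets every \<open>J3\<close> be pushed through \<open>\<pi>(a) V\<close> to become
  an \<open>\<alpha>\<close> and a \<open>J1\<close>. Therefore

    \<open>\<langle>\<pi>(a) V \<xi>, \<pi>(b) V \<eta>\<rangle> = \<langle>\<xi>, \<phi>(\<alpha>(a\<^sup>*) b) \<eta>\<rangle>\<close> and
    \<open>\<langle>\<pi>X(x) V \<xi>, \<pi>X(y) V \<eta>\<rangle> = \<langle>\<xi>, \<phi>(\<alpha>\<langle>x,y\<rangle>) (J1 \<eta>)\<rangle>\<close>.

  By minimality these vectors are total in the two modules, and two total families with the same
  Gram matrix are related by a unitary (\<open>equal_gram_imp_unitary\<close>). This gives
  \<open>U1 : \<pi>(a) V \<xi> \<mapsto> \<pi>'(a) V' \<xi>\<close> and \<open>U2 : \<pi>X(x) V \<xi> \<mapsto> \<pi>X'(x) V' \<xi>\<close>.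

  The rest is testing on total families. \<open>U1\<close> intertwines \<open>\<pi>\<close> with \<open>\<pi>'\<close> and, by the same
  commutation relation, \<open>J3\<close> with \<open>J3'\<close>; the latter makes \<open>U1\<^sup>#\<close> the inverse of \<open>U1\<close>.
  Minimality forces \<open>\<pi>\<close> to be unital, so \<open>a = 1\<close> yields \<open>U1 V = V'\<close>. Finally, \<open>U2 W = W'\<close> and
  \<open>U2 \<pi>X(x) = \<pi>X'(x) U1\<close> hold because both sides have the same inner products with all vectors
  \<open>\<pi>X'(y) V' \<eta>\<close>: in the first case \<open>\<langle>W h, \<pi>X(y) V \<eta>\<rangle> = \<langle>h, \<Phi>(y) \<eta>\<rangle>\<close>, which mentions only
  \<open>\<Phi>\<close>, and in the second case the inner products are taken in \<open>K1\<close> and \<open>K1'\<close>, where \<open>U1\<close>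
  is already known to respect all the data.
\<close>

section \<open>Closed linear spans\<close>

interpretation cspace: vector_space "scaleC :: complex \<Rightarrow> 'v \<Rightarrow> 'v::complex_banach"
  by (rule vector_space_scaleC)

lemma closed_cspan_induct [consumes 1, case_names base zero add scale closed]:
  fixes S :: "'v::complex_banach set"
  assumes "x \<in> closed_cspan S"
    and base: "\<And>x. x \<in> S \<Longrightarrow> P x"
    and zero: "P 0"
    and add: "\<And>x y. P x \<Longrightarrow> P y \<Longrightarrow> P (x + y)"
    and scale: "\<And>c x. P x \<Longrightarrow> P (c *\<^sub>C x)"
    and closed: "closed {x. P x}"
  shows "P x"
proof -
  have "cspace.span S \<subseteq> {x. P x}"
  proof
    fix y assume "y \<in> cspace.span S"
    then have "P y"
      by (induction rule: cspace.span_induct_alt) (auto intro: base zero add scale)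
    then show "y \<in> {x. P x}" by simp
  qed
  then have "closed_cspan S \<subseteq> {x. P x}"
    unfolding closed_cspan_def using closed by (rule closure_minimal)
  with assms(1) show ?thesis by blast
qed

lemma clinear_add: "clinear T \<Longrightarrow> T (x + y) = T x + T y"
  and clinear_scale: "clinear T \<Longrightarrow> T (c *\<^sub>C x) = c *\<^sub>C T x"
  by (simp_all add: Vector_Spaces.linear_iff)

lemma clinearI:
  assumes "\<And>x y. T (x + y) = T x + T y" and "\<And>c x. T (c *\<^sub>C x) = c *\<^sub>C T x"
  shows "clinear T"
  by (simp add: Vector_Spaces.linear_iff vector_space_scaleC assms)

lemma clinear_compose: "clinear S \<Longrightarrow> clinear T \<Longrightarrow> clinear (\<lambda>x. S (T x))"
  by (rule clinearI) (simp_all add: clinear_add clinear_scale)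

lemma clinear_eq_on_closed_cspan:
  assumes "clinear S" "bounded_linear S" "clinear T" "bounded_linear T"
    and "\<And>s. s \<in> G \<Longrightarrow> S s = T s" and "x \<in> closed_cspan G"
  shows "S x = T x"
  using assms(6)
proof (induction rule: closed_cspan_induct)
  case closed
  show ?case
    using assms(2,4) by (intro closed_Collect_eq) (auto intro: linear_continuous_on)
next
  case zero
  show ?case using assms(2,4) by (simp add: linear_simps)
qed (simp_all add: assms clinear_add clinear_scale)

section \<open>Inner products and adjoints\<close>

lemma hilbert_module_ip:
  assumes "hilbert_module H"
  shows ip_add_right: "ip H x (y + z) = ip H x y + ip H x z"
    and ip_scale_right: "ip H x (k *\<^sub>C y) = k *\<^sub>C ip H x y"
    and ip_conj: "ip H y x = star (ip H x y)"
    and ip_definite: "ip H x x = 0 \<Longrightarrow> x = 0"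
    and norm_ip_self: "norm (ip H x x) = (norm x)\<^sup>2"
proof -
  have ax: "\<forall>x y z. ip H x (y + z) = ip H x y + ip H x z"
    "\<forall>k x y. ip H x (k *\<^sub>C y) = k *\<^sub>C ip H x y"
    "\<forall>x y. ip H y x = star (ip H x y)"
    "\<forall>x. ip H x x = 0 \<longrightarrow> x = 0"
    "\<forall>x. norm x = sqrt (norm (ip H x x))"
    using assms unfolding hilbert_module_def by - (elim conjE, assumption)+
  show "ip H x (y + z) = ip H x y + ip H x z" by (rule ax(1)[rule_format])
  show "ip H x (k *\<^sub>C y) = k *\<^sub>C ip H x y" by (rule ax(2)[rule_format])
  show "ip H y x = star (ip H x y)" by (rule ax(3)[rule_format])
  show "ip H x x = 0 \<Longrightarrow> x = 0" by (rule ax(4)[rule_format])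
  show "norm (ip H x x) = (norm x)\<^sup>2" by (simp add: ax(5)[rule_format, of x])
qed

lemma ip_add_left:
  assumes "hilbert_module H"
  shows "ip H (x + y) z = ip H x z + ip H y z"
  unfolding ip_conj[OF assms, of "x + y" z] ip_conj[OF assms, of x z] ip_conj[OF assms, of y z]
  by (simp add: ip_add_right[OF assms] star_add)

lemma ip_scale_left:
  assumes "hilbert_module H"
  shows "ip H (k *\<^sub>C x) y = cnj k *\<^sub>C ip H x y"
  unfolding ip_conj[OF assms, of "k *\<^sub>C x" y] ip_conj[OF assms, of x y]
  by (simp add: ip_scale_right[OF assms] star_scaleC)

text \<open>Polarisation, split into the symmetric and the antisymmetric part of the inner product.\<close>

lemma ip_polarisation:
  assumes H: "hilbert_module H"
  defines "q \<equiv> \<lambda>u. ip H u u"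
  shows "4 *\<^sub>C ip H x y = (q (x + 1 *\<^sub>C y) - q (x + (-1) *\<^sub>C y))
    + (-\<i>) *\<^sub>C (q (x + \<i> *\<^sub>C y) - q (x + (-\<i>) *\<^sub>C y))"
proof -
  have q: "q (x + c *\<^sub>C y) =
      ip H x x + c *\<^sub>C ip H x y + cnj c *\<^sub>C ip H y x + (cnj c * c) *\<^sub>C ip H y y" for c
    by (simp add: q_def ip_add_left[OF H] ip_add_right[OF H] ip_scale_left[OF H]
        ip_scale_right[OF H] scaleC_scaleC scaleC_add_right)
  have four: "4 *\<^sub>C z = z + z + z + z" for z :: 'b
  proof -
    have "(4::complex) = 1 + 1 + 1 + 1" by simp
    then show ?thesis by (simp only: scaleC_add_left scaleC_one)
  qed
  show ?thesis
    unfolding q four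
    by (simp add: scaleC_scaleC scaleC_add_right cspace.scale_right_diff_distrib
        scaleC_one cspace.scale_minus_left)
qed

text \<open>
  What matters here is joint continuity of the inner product, so a constant worse than in the
  Cauchy--Schwarz inequality will do. For unit vectors polarisation expresses the inner product as
  a quarter of four terms \<open>\<langle>u,u\<rangle>\<close> with \<open>norm u \<le> 2\<close>, which gives 4; the general case follows by
  scaling.
\<close>

lemma bounded_bilinear_ip:
  assumes H: "hilbert_module H"
  shows "bounded_bilinear (ip H)"
proof
  fix x x' y y' and r :: real
  show "ip H (x + x') y = ip H x y + ip H x' y" "ip H x (y + y') = ip H x y + ip H x y'"
    using H by (rule ip_add_left, rule ip_add_right)
  show sl: "ip H (r *\<^sub>R x) y = r *\<^sub>R ip H x y" for x y r
    by (simp add: scaleR_scaleC ip_scale_left[OF H])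
  show sr: "ip H x (r *\<^sub>R y) = r *\<^sub>R ip H x y" for x y r
    by (simp add: scaleR_scaleC ip_scale_right[OF H])
  have unit: "norm (ip H u v) \<le> 4" if "norm u = 1" "norm v = 1" for u v
  proof -
    have q: "norm (ip H (u + c *\<^sub>C v) (u + c *\<^sub>C v)) \<le> 4" if "cmod c = 1" for c
    proof -
      have "norm (u + c *\<^sub>C v) \<le> 2"
        using norm_triangle_ineq[of u "c *\<^sub>C v"] \<open>norm u = 1\<close> \<open>norm v = 1\<close> that
        by (simp add: norm_scaleC)
      then have "(norm (u + c *\<^sub>C v))\<^sup>2 \<le> 2\<^sup>2" by (intro power_mono) auto
      then show ?thesis by (simp add: norm_ip_self[OF H])
    qed
    have d: "norm (ip H (u + c *\<^sub>C v) (u + c *\<^sub>C v) - ip H (u + d *\<^sub>C v) (u + d *\<^sub>C v)) \<le> 8"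
      if "cmod c = 1" "cmod d = 1" for c d
      by (rule order_trans[OF norm_triangle_ineq4]) (use q[OF that(1)] q[OF that(2)] in linarith)
    have "norm (4 *\<^sub>C ip H u v) \<le> 8 + 8"
      unfolding ip_polarisation[OF H, of u v]
    proof (rule norm_triangle_le, rule add_mono)
      show "norm ((-\<i>) *\<^sub>C (ip H (u + \<i> *\<^sub>C v) (u + \<i> *\<^sub>C v)
              - ip H (u + (-\<i>) *\<^sub>C v) (u + (-\<i>) *\<^sub>C v))) \<le> 8"
        unfolding norm_scaleC using d[of "\<i>" "-\<i>"] by simp
    qed (rule d; simp)
    then show ?thesis by (simp add: norm_scaleC)
  qed
  show "\<exists>K. \<forall>x y. norm (ip H x y) \<le> norm x * norm y * K"
  proof (intro exI[of _ 4] allI)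
    fix x y
    show "norm (ip H x y) \<le> norm x * norm y * 4"
    proof (cases "x = 0 \<or> y = 0")
      case True
      then show ?thesis using sl[of 0 x y] sr[of x 0 y] by auto
    next
      case False
      define u v where "u = (1 / norm x) *\<^sub>R x" and "v = (1 / norm y) *\<^sub>R y"
      have xy: "norm x *\<^sub>R u = x" "norm y *\<^sub>R v = y" using False by (auto simp: u_def v_def)
      have "ip H (norm x *\<^sub>R u) (norm y *\<^sub>R v) = (norm x * norm y) *\<^sub>R ip H u v"
        by (simp only: sl sr scaleR_scaleR mult.commute)
      then have "ip H x y = (norm x * norm y) *\<^sub>R ip H u v" unfolding xy .
      moreover have "norm (ip H u v) \<le> 4" using False by (intro unit) (auto simp: u_def v_def)
      ultimately show ?thesis by (simp add: mult_left_mono)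
    qed
  qed
qed

text \<open>
  This is how two vectors are shown to be equal below: their difference is orthogonal to a total
  set, hence to itself.
\<close>

lemma ip_eq_on_total:
  assumes H: "hilbert_module H" and total: "closed_cspan G = UNIV"
    and eq: "\<And>s. s \<in> G \<Longrightarrow> ip H y s = ip H y' s"
  shows "y = y'"
proof -
  interpret bounded_bilinear "ip H" by (rule bounded_bilinear_ip[OF H])
  have "ip H (y - y') z = 0" for z
  proof -
    have "z \<in> closed_cspan G" using total by simp
    then show ?thesis
    proof (induction rule: closed_cspan_induct)
      case closed
      show ?case
        using bounded_linear_right
        by (intro closed_Collect_eq) (auto intro: linear_continuous_on)
    qed (simp_all add: eq diff_left zero_right add_right ip_scale_right[OF H])
  qed
  then have "ip H (y - y') (y - y') = 0" .
  then show ?thesis using ip_definite[OF H] eq_iff_diff_eq_0 by blast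
qed

lemma is_adjoint_unique:
  assumes H: "hilbert_module H" and "is_adjoint H K T S" "is_adjoint H K T S'"
  shows "S = S'"
proof
  fix y
  interpret bounded_bilinear "ip H" by (rule bounded_bilinear_ip[OF H])
  have "ip H x (S y - S' y) = 0" for x
    using assms(2,3) by (simp add: is_adjoint_def diff_right)
  then show "S y = S' y" using ip_definite[OF H] eq_iff_diff_eq_0 by blast
qed

lemma adj_eqI: "hilbert_module H \<Longrightarrow> is_adjoint H K T S \<Longrightarrow> adj H K T = S"
  unfolding adj_def by (blast intro: is_adjoint_unique)

lemma ip_adj:
  assumes "hilbert_module H" "T \<in> adjointable H K"
  shows "ip K (T x) y = ip H x (adj H K T y)"
  using assms adj_eqI unfolding adjointable_def is_adjoint_def by blast

section \<open>Unitaries from equal Gram matrices\<close>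

text \<open>
  The graph of the unitary: the closed linear relation generated by the pairs \<open>(f i, g i)\<close>.
  Being symmetric in \<open>f\<close> and \<open>g\<close>, it provides the map and its inverse at once, and its
  properties follow by rule induction with no choice of linear combinations.
\<close>

inductive closed_span_rel ::
    "('i \<Rightarrow> 'k::complex_banach) \<Rightarrow> ('i \<Rightarrow> 'l::complex_banach) \<Rightarrow> 'k \<Rightarrow> 'l \<Rightarrow> bool"
  for f g where
  gen: "closed_span_rel f g (f i) (g i)"
| zero: "closed_span_rel f g 0 0"
| add: "closed_span_rel f g k l \<Longrightarrow> closed_span_rel f g k' l'
    \<Longrightarrow> closed_span_rel f g (k + k') (l + l')"
| scale: "closed_span_rel f g k l \<Longrightarrow> closed_span_rel f g (c *\<^sub>C k) (c *\<^sub>C l)"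
| lim: "(\<And>n::nat. closed_span_rel f g (ks n) (ls n)) \<Longrightarrow> ks \<longlonglongrightarrow> k \<Longrightarrow> ls \<longlonglongrightarrow> l
    \<Longrightarrow> closed_span_rel f g k l"

lemma closed_span_rel_swap: "closed_span_rel f g k l \<Longrightarrow> closed_span_rel g f l k"
  by (induction rule: closed_span_rel.induct) (auto intro: closed_span_rel.intros)

lemma closed_span_rel_diff:
  assumes "closed_span_rel f g k l" "closed_span_rel f g k' l'"
  shows "closed_span_rel f g (k - k') (l - l')"
  using closed_span_rel.add[OF assms(1) closed_span_rel.scale[OF assms(2), of "-1"]]
  by (simp add: cspace.scale_minus_left scaleC_one)

lemma closed_span_rel_ip:
  assumes K: "hilbert_module K" and L: "hilbert_module L"
    and gram: "\<And>i j. ip K (f i) (f j) = ip L (g i) (g j)"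
    and kl: "closed_span_rel f g k l" and kl': "closed_span_rel f g k' l'"
  shows "ip K k k' = ip L l l'"
proof -
  interpret K: bounded_bilinear "ip K" by (rule bounded_bilinear_ip[OF K])
  interpret L: bounded_bilinear "ip L" by (rule bounded_bilinear_ip[OF L])
  \<comment> \<open>One argument at a time: first the right one against generators, then the left one.\<close>
  have right: "ip K (f i) k' = ip L (g i) l'" for i
    using kl'
  proof induction
    case (lim ks ls k l)
    have "(\<lambda>n. ip K (f i) (ks n)) \<longlonglongrightarrow> ip K (f i) k" "(\<lambda>n. ip L (g i) (ls n)) \<longlonglongrightarrow> ip L (g i) l"
      by (intro K.tendsto L.tendsto tendsto_const lim.hyps)+
    with lim.IH show ?case by (simp add: LIMSEQ_unique)
  qed (simp_all add: gram K.zero_right L.zero_right K.add_right L.add_right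
      ip_scale_right[OF K] ip_scale_right[OF L])
  show ?thesis
    using kl
  proof induction
    case (lim ks ls k l)
    have "(\<lambda>n. ip K (ks n) k') \<longlonglongrightarrow> ip K k k'" "(\<lambda>n. ip L (ls n) l') \<longlonglongrightarrow> ip L l l'"
      by (intro K.tendsto L.tendsto tendsto_const lim.hyps)+
    with lim.IH show ?case by (simp add: LIMSEQ_unique)
  qed (simp_all add: right K.zero_left L.zero_left K.add_left L.add_left
      ip_scale_left[OF K] ip_scale_left[OF L])
qed

lemma closed_span_rel_norm:
  assumes "hilbert_module K" and "hilbert_module L"
    and "\<And>i j. ip K (f i) (f j) = ip L (g i) (g j)"
    and "closed_span_rel f g k l"
  shows "norm k = norm l"
  using closed_span_rel_ip[OF assms assms(4)] norm_ip_self[OF assms(1), of k]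
    norm_ip_self[OF assms(2), of l]
  by (metis norm_ge_zero power2_eq_iff_nonneg)

text \<open>
  The domain is closed: along a convergent sequence of first components the second components
  are Cauchy, because the relation is isometric.
\<close>

lemma closed_span_rel_total:
  assumes K: "hilbert_module K" and L: "hilbert_module L"
    and gram: "\<And>i j. ip K (f i) (f j) = ip L (g i) (g j)"
    and total: "closed_cspan (range f) = UNIV"
  shows "\<exists>l. closed_span_rel f g k l"
proof -
  have "k \<in> closed_cspan (range f)" using total by simp
  then show ?thesis
  proof (induction rule: closed_cspan_induct)
    case closed
    show ?case
      unfolding closed_sequential_limits
    proof (intro allI impI, elim conjE)
      fix ks k assume "\<forall>n. ks n \<in> {k. \<exists>l. closed_span_rel f g k l}" and lim: "ks \<longlonglongrightarrow> k"
      then obtain ls where rel: "\<And>n. closed_span_rel f g (ks n) (ls n)"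
        by simp metis
      have "dist (ls m) (ls n) = dist (ks m) (ks n)" for m n
        using closed_span_rel_norm[OF K L gram closed_span_rel_diff[OF rel rel]]
        by (simp add: dist_norm)
      then have "Cauchy ls"
        using LIMSEQ_imp_Cauchy[OF lim] by (simp add: Cauchy_def)
      then obtain l where "ls \<longlonglongrightarrow> l" using Cauchy_convergent convergent_def by blast
      with rel lim show "k \<in> {k. \<exists>l. closed_span_rel f g k l}"
        by (auto intro: closed_span_rel.lim)
    qed
  qed (auto intro: closed_span_rel.intros)
qed

lemma isometric_inverse_imp_unitary:
  assumes K: "hilbert_module K" and L: "hilbert_module L"
    and lin: "clinear U" and ip: "\<And>x y. ip L (U x) (U y) = ip K x y"
    and UU': "\<And>y. U (U' y) = y" and U'U: "\<And>x. U' (U x) = x"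
  shows "unitary K L U"
proof -
  have "norm (U x) = norm x" for x
    using norm_ip_self[OF K, of x] norm_ip_self[OF L, of "U x"] ip
    by (metis norm_ge_zero power2_eq_iff_nonneg)
  then have "bounded_linear U"
    by (intro bounded_linear_intro[of _ 1]) (simp_all add: clinear_add[OF lin] scaleR_scaleC clinear_scale[OF lin])
  moreover have "is_adjoint K L U U'"
    unfolding is_adjoint_def by (metis ip UU')
  ultimately show ?thesis
    unfolding unitary_def adjointable_def adj_eqI[OF K \<open>is_adjoint K L U U'\<close>]
    using lin UU' U'U by auto
qed

text \<open>
  Gram matrices with respect to \<open>f\<close> and \<open>g\<close> agree, so the closed relation generated by the pairs
  \<open>(f i, g i)\<close> is isometric, hence single-valued in both directions, and it is total in both
  directions because the two families are.
\<close>

theorem equal_gram_imp_unitary: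
  assumes K: "hilbert_module K" and L: "hilbert_module L"
    and gram: "\<And>i j. ip K (f i) (f j) = ip L (g i) (g j)"
    and f: "closed_cspan (range f) = UNIV" and g: "closed_cspan (range g) = UNIV"
  shows "\<exists>U. unitary K L U \<and> (\<forall>i. U (f i) = g i)"
proof -
  obtain U where U: "\<And>k. closed_span_rel f g k (U k)"
    using closed_span_rel_total[OF K L gram f] by metis
  obtain U' where U': "\<And>l. closed_span_rel g f l (U' l)"
    using closed_span_rel_total[OF L K gram[symmetric] g] by metis
  have unique: "l = l'" if "closed_span_rel f g k l" "closed_span_rel f g k l'" for k l l'
    using closed_span_rel_norm[OF K L gram closed_span_rel_diff[OF that]] by simp
  have unique': "k = k'" if "closed_span_rel g f l k" "closed_span_rel g f l k'" for k k' l
    using closed_span_rel_norm[OF L K gram[symmetric] closed_span_rel_diff[OF that]] by simp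
  have "unitary K L U"
  proof (rule isometric_inverse_imp_unitary[OF K L, where U' = U'])
    show "clinear U"
      by (intro clinearI) (blast intro: unique U closed_span_rel.add closed_span_rel.scale)+
    show "ip L (U x) (U y) = ip K x y" for x y
      using closed_span_rel_ip[OF K L gram U U] by simp
    show "U (U' y) = y" for y
      by (rule unique[OF U closed_span_rel_swap[OF U']])
    show "U' (U x) = x" for x
      by (rule unique'[OF U' closed_span_rel_swap[OF U]])
  qed
  moreover have "U (f i) = g i" for i
    by (rule unique[OF U closed_span_rel.gen])
  ultimately show ?thesis by blast
qed

lemma unitaryD:
  assumes "hilbert_module K" "unitary K L U"
  shows "clinear U" "bounded_linear U" "U (adj K L U y) = y"
    and "ip L (U x) (U z) = ip K x z"
proof -
  show "clinear U" "bounded_linear U" "U (adj K L U y) = y"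
    using assms(2) unfolding unitary_def adjointable_def by (auto dest: fun_cong)
  have "U \<in> adjointable K L" "adj K L U (U z) = z"
    using assms(2) unfolding unitary_def by (auto dest: fun_cong)
  then show "ip L (U x) (U z) = ip K x z"
    by (simp add: ip_adj[OF assms(1)])
qed

section \<open>Gram data of a minimal KSGNS construction\<close>

text \<open>
  The second fundamental symmetries are identities throughout, so they are not parameters.
\<close>

locale minimal_ksgns =
  fixes \<alpha> :: "'a::cstar_algebra \<Rightarrow> 'a"
    and H1 :: "('h1::complex_banach, 'b::cstar_algebra) hilbert_mod" and J1 :: "'h1 \<Rightarrow> 'h1"
    and H2 :: "('h2::complex_banach, 'b) hilbert_mod"
    and \<phi> :: "'a \<Rightarrow> 'h1 \<Rightarrow> 'h1"
    and X :: "('x::complex_banach, 'a) hilbert_mod"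
    and \<Phi> :: "'x \<Rightarrow> 'h1 \<Rightarrow> 'h2"
    and \<pi>X :: "'x \<Rightarrow> 'k1::complex_banach \<Rightarrow> 'k2::complex_banach" and \<pi> :: "'a \<Rightarrow> 'k1 \<Rightarrow> 'k1"
    and V :: "'h1 \<Rightarrow> 'k1" and W :: "'h2 \<Rightarrow> 'k2"
    and K1 :: "('k1, 'b) hilbert_mod" and J3 :: "'k1 \<Rightarrow> 'k1"
    and K2 :: "('k2, 'b) hilbert_mod"
  assumes krein_alg: "krein_cstar_algebra \<alpha>" and "unital TYPE('a)"
    and krein1: "krein_module (H1, J1)" and krein2: "krein_module (H2, id)"
    and minimal: "minimal_ksgns_construction \<alpha> X (H1, J1) (H2, id) \<phi> \<Phi>
           (\<pi>X, \<pi>, V, W, (K1, J3), (K2, id))"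
begin

lemma hilbert: "hilbert_module H1" "hilbert_module H2" "hilbert_module K1" "hilbert_module K2"
  using krein1 krein2 minimal by simp_all

lemma J1_J1: "J1 (J1 \<xi>) = \<xi>" and J3_J3: "J3 (J3 k) = k"
  using krein1 minimal by (auto dest: fun_cong)

lemma J3_adjointable: "J3 \<in> adjointable K1 K1"
  and V_adjointable: "V \<in> adjointable H1 K1"
  and W_adjointable: "W \<in> adjointable H2 K2"
  and \<pi>_adjointable: "\<pi> a \<in> adjointable K1 K1"
  and \<pi>X_adjointable: "\<pi>X x \<in> adjointable K1 K2"
  using minimal by (simp_all add: bounded_linear_op_map_def)

lemma ip_J3: "ip K1 (J3 k) k' = ip K1 k (J3 k')"
  using ip_adj[OF hilbert(3) J3_adjointable] minimal by simp

lemma \<pi>_mult: "\<pi> (a * b) k = \<pi> a (\<pi> b k)"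
  using minimal by simp

lemma adj_\<pi>: "adj K1 K1 (\<pi> a) k = J3 (\<pi> (star a) (J3 k))"
  using minimal by (simp add: J3_J3)

lemma adj_\<pi>X_\<pi>X: "adj K1 K2 (\<pi>X x) (\<pi>X y k) = J3 (\<pi> (ip X x y) k)"
proof -
  have "J3 (adj K1 K2 (\<pi>X x) (\<pi>X y k)) = \<pi> (ip X x y) k"
    using minimal by (auto dest!: fun_cong simp: fun_eq_iff)
  then show ?thesis by (metis J3_J3)
qed

lemma adj_V_\<pi>_V: "adj H1 K1 V (\<pi> a (V \<xi>)) = \<phi> a \<xi>"
  using minimal by simp

lemma adj_W_\<pi>X_V: "adj H2 K2 W (\<pi>X x (V \<xi>)) = \<Phi> x \<xi>"
  using minimal by simp

lemma J3_\<pi>_V: "J3 (\<pi> a (V \<xi>)) = \<pi> (\<alpha> a) (V (J1 \<xi>))"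
proof -
  have "\<pi> (\<alpha> a) \<circ> V = J3 \<circ> \<pi> a \<circ> V \<circ> J1"
    using minimal by simp
  from fun_cong[OF this, of "J1 \<xi>"] show ?thesis by (simp add: J1_J1)
qed

lemma total1: "closed_cspan (range (\<lambda>(a, \<xi>). \<pi> a (V \<xi>))) = UNIV"
proof -
  have "range (\<lambda>(a, \<xi>). \<pi> a (V \<xi>)) = {\<pi> a (V \<xi>) | a \<xi>. True}" by auto
  then show ?thesis using minimal by simp
qed

lemma total2: "closed_cspan (range (\<lambda>(x, \<xi>). \<pi>X x (V \<xi>))) = UNIV"
proof -
  have "range (\<lambda>(x, \<xi>). \<pi>X x (V \<xi>)) = {\<pi>X x (V \<xi>) | x \<xi>. True}" by auto
  then show ?thesis using minimal by simp
qed

lemma \<alpha>_mult: "\<alpha> (a * b) = \<alpha> a * \<alpha> b" and \<alpha>_\<alpha>: "\<alpha> (\<alpha> a) = a"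
  using krein_alg by (auto simp: krein_cstar_algebra_def dest: fun_cong)

text \<open>
  Each of the two symmetries in \<open>\<pi>(a)\<^sup>* = J3 \<pi>(a\<^sup>*) J3\<close> is moved to the right past \<open>\<pi>(\<cdot>) V\<close>; the
  two resulting copies of \<open>J1\<close> cancel.
\<close>

lemma gram1: "ip K1 (\<pi> a (V \<xi>)) (\<pi> b (V \<eta>)) = ip H1 \<xi> (\<phi> (\<alpha> (star a) * b) \<eta>)"
proof -
  have "J3 (\<pi> (star a) (J3 (\<pi> b (V \<eta>)))) = \<pi> (\<alpha> (star a) * b) (V \<eta>)"
    by (simp add: J3_\<pi>_V J1_J1 \<alpha>_mult \<alpha>_\<alpha> flip: \<pi>_mult)
  then show ?thesis
    by (simp add: ip_adj[OF hilbert(3) \<pi>_adjointable] adj_\<pi> adj_V_\<pi>_V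
        ip_adj[OF hilbert(1) V_adjointable])
qed

lemma ip_\<pi>X: "ip K2 (\<pi>X x k) (\<pi>X y k') = ip K1 k (J3 (\<pi> (ip X x y) k'))"
  by (simp add: ip_adj[OF hilbert(3) \<pi>X_adjointable] adj_\<pi>X_\<pi>X)

lemma gram2: "ip K2 (\<pi>X x (V \<xi>)) (\<pi>X y (V \<eta>)) = ip H1 \<xi> (\<phi> (\<alpha> (ip X x y)) (J1 \<eta>))"
  by (simp add: ip_\<pi>X J3_\<pi>_V ip_adj[OF hilbert(1) V_adjointable] adj_V_\<pi>_V)

lemma ip_W: "ip K2 (W h) (\<pi>X x (V \<xi>)) = ip H2 h (\<Phi> x \<xi>)"
  by (simp add: ip_adj[OF hilbert(2) W_adjointable] adj_W_\<pi>X_V)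

text \<open>A unit acts as the identity on the total vectors \<open>\<pi>(a) V \<xi>\<close>, hence everywhere.\<close>

lemma \<pi>_unit:
  assumes "\<And>a. e * a = a"
  shows "\<pi> e k = k"
proof -
  have "\<pi> e k = id k"
  proof (rule clinear_eq_on_closed_cspan[where S = "\<pi> e" and T = id and x = k])
    show "k \<in> closed_cspan (range (\<lambda>(a, \<xi>). \<pi> a (V \<xi>)))" using total1 by simp
    show "clinear (id :: 'k1 \<Rightarrow> 'k1)" by (rule clinearI) simp_all
    show "bounded_linear (id :: 'k1 \<Rightarrow> 'k1)" by (simp add: id_def)
  qed (use \<pi>_adjointable[of e] in \<open>auto simp: adjointable_def assms simp flip: \<pi>_mult\<close>)
  then show ?thesis by simp
qed

end

section \<open>Uniqueness\<close>

theorem proposition2p10: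
  fixes \<alpha> :: "'a::cstar_algebra \<Rightarrow> 'a"
    and H1 :: "('h1::complex_banach, 'b::cstar_algebra) hilbert_mod" and J1 :: "'h1 \<Rightarrow> 'h1"
    and H2 :: "('h2::complex_banach, 'b) hilbert_mod" and J2 :: "'h2 \<Rightarrow> 'h2"
    and \<phi> :: "'a \<Rightarrow> 'h1 \<Rightarrow> 'h1"
    and X :: "('x::complex_banach, 'a) hilbert_mod"
    and \<Phi> :: "'x \<Rightarrow> 'h1 \<Rightarrow> 'h2"
    and K1 :: "('k1::complex_banach, 'b) hilbert_mod" and J3 :: "'k1 \<Rightarrow> 'k1"
    and K2 :: "('k2::complex_banach, 'b) hilbert_mod" and J4 :: "'k2 \<Rightarrow> 'k2"
    and K1' :: "('l1::complex_banach, 'b) hilbert_mod" and J3' :: "'l1 \<Rightarrow> 'l1"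
    and K2' :: "('l2::complex_banach, 'b) hilbert_mod" and J4' :: "'l2 \<Rightarrow> 'l2"
    and \<pi>X :: "'x \<Rightarrow> 'k1 \<Rightarrow> 'k2" and \<pi> :: "'a \<Rightarrow> 'k1 \<Rightarrow> 'k1"
    and V :: "'h1 \<Rightarrow> 'k1" and W :: "'h2 \<Rightarrow> 'k2"
    and \<pi>X' :: "'x \<Rightarrow> 'l1 \<Rightarrow> 'l2" and \<pi>' :: "'a \<Rightarrow> 'l1 \<Rightarrow> 'l1"
    and V' :: "'h1 \<Rightarrow> 'l1" and W' :: "'h2 \<Rightarrow> 'l2"
  assumes "krein_cstar_algebra \<alpha>" and "unital TYPE('a)"
    and "krein_module (H1, J1)"
    and "krein_module (H2, J2)" and "J2 = id"
    and "alpha_cp \<alpha> (H1, J1) \<phi>"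
    and "hilbert_module X"
    and "phi_map \<phi> X (H1, J1) (H2, J2) \<Phi>"
    and "minimal_ksgns_construction \<alpha> X (H1, J1) (H2, J2) \<phi> \<Phi>
           (\<pi>X, \<pi>, V, W, (K1, J3), (K2, J4))"
    and "minimal_ksgns_construction \<alpha> X (H1, J1) (H2, J2) \<phi> \<Phi>
           (\<pi>X', \<pi>', V', W', (K1', J3'), (K2', J4'))"
  shows "\<exists>U1 U2. unitary K1 K1' U1 \<and> unitary K2 K2' U2 \<and>
           (U1 \<circ> V = V' \<and> (\<forall>a. U1 \<circ> \<pi> a \<circ> sharp (K1, J3) (K1', J3') U1 = \<pi>' a)) \<and>
           (U2 \<circ> W = W' \<and> (\<forall>x. U2 \<circ> \<pi>X x \<circ> sharp (K1, J3) (K1', J3') U1 = \<pi>X' x))"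
proof -
  have "J4 = id" "J4' = id" using assms(9,10) by simp_all
  interpret A: minimal_ksgns \<alpha> H1 J1 H2 \<phi> X \<Phi> \<pi>X \<pi> V W K1 J3 K2
    using assms \<open>J4 = id\<close> by unfold_locales simp_all
  interpret B: minimal_ksgns \<alpha> H1 J1 H2 \<phi> X \<Phi> \<pi>X' \<pi>' V' W' K1' J3' K2'
    using assms \<open>J4' = id\<close> by unfold_locales simp_all

  obtain U1 where U1: "unitary K1 K1' U1"
    and "\<forall>i. U1 (case i of (a, \<xi>) \<Rightarrow> \<pi> a (V \<xi>)) = (case i of (a, \<xi>) \<Rightarrow> \<pi>' a (V' \<xi>))"
    using equal_gram_imp_unitary[OF A.hilbert(3) B.hilbert(3) _ A.total1 B.total1]
    by (auto simp: A.gram1 B.gram1)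
  then have U1_gen: "U1 (\<pi> a (V \<xi>)) = \<pi>' a (V' \<xi>)" for a \<xi> by auto
  obtain U2 where U2: "unitary K2 K2' U2"
    and "\<forall>i. U2 (case i of (x, \<xi>) \<Rightarrow> \<pi>X x (V \<xi>)) = (case i of (x, \<xi>) \<Rightarrow> \<pi>X' x (V' \<xi>))"
    using equal_gram_imp_unitary[OF A.hilbert(4) B.hilbert(4) _ A.total2 B.total2]
    by (auto simp: A.gram2 B.gram2)
  then have U2_gen: "U2 (\<pi>X x (V \<xi>)) = \<pi>X' x (V' \<xi>)" for x \<xi> by auto
  note U1D = unitaryD[OF A.hilbert(3) U1] and U2D = unitaryD[OF A.hilbert(4) U2]

  \<comment> \<open>Used for \<open>T = \<pi> a\<close> and for \<open>T = J3\<close>: both map the total vectors to vectors of the same form.\<close>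
  have intertwine: "U1 (T k) = T' (U1 k)"
    if T: "T \<in> adjointable K1 K1" and T': "T' \<in> adjointable K1' K1'"
      and gen: "\<And>b \<xi>. U1 (T (\<pi> b (V \<xi>))) = T' (\<pi>' b (V' \<xi>))" for T T' k
  proof (rule clinear_eq_on_closed_cspan[where S = "\<lambda>k. U1 (T k)" and T = "\<lambda>k. T' (U1 k)" and x = k])
    show "clinear (\<lambda>k. U1 (T k))" "clinear (\<lambda>k. T' (U1 k))"
      using T T' U1D(1) by (auto simp: adjointable_def intro: clinear_compose)
    show "bounded_linear (\<lambda>k. U1 (T k))" "bounded_linear (\<lambda>k. T' (U1 k))"
      using T T' U1D(2) by (auto simp: adjointable_def intro: bounded_linear_compose)
    show "k \<in> closed_cspan (range (\<lambda>(a, \<xi>). \<pi> a (V \<xi>)))" using A.total1 by simp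
  qed (auto simp: gen U1_gen)
  have U1_\<pi>: "U1 (\<pi> a k) = \<pi>' a (U1 k)" for a k
    by (rule intertwine[OF A.\<pi>_adjointable B.\<pi>_adjointable])
      (simp add: U1_gen flip: A.\<pi>_mult B.\<pi>_mult)
  have U1_J: "U1 (J3 k) = J3' (U1 k)" for k
    by (rule intertwine[OF A.J3_adjointable B.J3_adjointable])
      (simp add: U1_gen A.J3_\<pi>_V B.J3_\<pi>_V)
  \<comment> \<open>Pulling \<open>J3\<close> out through \<open>U1\<close> turns \<open>U1 J3 U1\<^sup>* J3'\<close> into \<open>J3' U1 U1\<^sup>* J3' = id\<close>.\<close>
  have U1_sharp: "U1 (sharp (K1, J3) (K1', J3') U1 l) = l" for l
    by (simp add: U1_J U1D(3) B.J3_J3)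

  have U2_\<pi>X: "U2 (\<pi>X x k) = \<pi>X' x (U1 k)" for x k
  proof (rule ip_eq_on_total[OF B.hilbert(4) B.total2])
    fix s assume "s \<in> range (\<lambda>(x, \<xi>). \<pi>X' x (V' \<xi>))"
    then obtain y \<eta> where s: "s = \<pi>X' y (V' \<eta>)" by auto
    have "ip K2' (U2 (\<pi>X x k)) s = ip K1 k (J3 (\<pi> (ip X x y) (V \<eta>)))"
      unfolding s U2_gen[symmetric] by (simp add: U2D(4) A.ip_\<pi>X)
    also have "\<dots> = ip K1' (U1 k) (J3' (\<pi>' (ip X x y) (V' \<eta>)))"
      by (simp add: U1_gen U1_J flip: U1D(4))
    also have "\<dots> = ip K2' (\<pi>X' x (U1 k)) s"
      by (simp add: s B.ip_\<pi>X)
    finally show "ip K2' (U2 (\<pi>X x k)) s = ip K2' (\<pi>X' x (U1 k)) s" .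
  qed
  have U2_W: "U2 (W h) = W' h" for h
  proof (rule ip_eq_on_total[OF B.hilbert(4) B.total2])
    fix s assume "s \<in> range (\<lambda>(x, \<xi>). \<pi>X' x (V' \<xi>))"
    then obtain y \<eta> where s: "s = \<pi>X' y (V' \<eta>)" by auto
    have "ip K2' (U2 (W h)) s = ip H2 h (\<Phi> y \<eta>)"
      unfolding s U2_gen[symmetric] by (simp add: U2D(4) A.ip_W)
    then show "ip K2' (U2 (W h)) s = ip K2' (W' h) s"
      by (simp add: s B.ip_W)
  qed
  obtain e :: 'a where e: "\<And>a. e * a = a"
    using assms(2) unfolding unital_def by blast
  have U1_V: "U1 (V \<xi>) = V' \<xi>" for \<xi>
    using U1_gen[of e \<xi>] by (simp add: A.\<pi>_unit[OF e] B.\<pi>_unit[OF e])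

  show ?thesis
    using U1 U2 U1_sharp
    by (intro exI[of _ U1] exI[of _ U2])
      (auto simp: fun_eq_iff U1_V U1_\<pi> U2_W U2_\<pi>X simp del: sharp.simps)
qed

end
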